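(* Let $G$ be a finite abstract simplicial complex, let $x\in G$ and let $m\ge1$ be an integer. Then $$ w_m(B(x))=w_m(U(x))-(-1)^m\,w_m(S(x)). $$
   Context: A finite abstract simplicial complex $G$ is a finite set of non-empty finite sets, closed under taking non-empty subsets. For $x\in G$, $\dim(x)=|x|-1$ and $w(x)=(-1)^{\dim(x)}$. The star of $x$ is $U(x)=\{y\in G : x\subseteq y\}$; the unit ball is its closure $B(x)=\overline{U(x)}=\{z\in G: z\subseteq y\text{ for some }y\in U(x)\}$; the unit sphere is $S(x)=B(x)\setminus U(x)$. For any subset $A\subseteq G$, $$ w_m(A)=\sum_{(x_1,\dots,x_m)\in A^m,\ x_1\cap\cdots\cap x_m\in A}\ \prod_{j=1}^m w(x_j), $$ with $w_m(\emptyset)=0$. *)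

theory Defs
  imports Main "HOL-Library.FuncSet"
begin

definition finite_abstract_simplicial_complex :: "'a set set \<Rightarrow> bool" where
  "finite_abstract_simplicial_complex G \<longleftrightarrow>
     finite G \<and> (\<forall>x\<in>G. finite x \<and> x \<noteq> {}) \<and>
     (\<forall>x\<in>G. \<forall>y. y \<subseteq> x \<and> y \<noteq> {} \<longrightarrow> y \<in> G)"

text \<open>Simplices are non-empty, so the truncated subtraction is harmless.\<close>

definition simplex_dim :: "'a set \<Rightarrow> nat" where
  "simplex_dim x = card x - 1"

definition simplex_weight :: "'a set \<Rightarrow> int" where
  "simplex_weight x = (-1) ^ simplex_dim x"

definition star :: "'a set set \<Rightarrow> 'a set \<Rightarrow> 'a set set" where
  "star G x = {y \<in> G. x \<subseteq> y}"

definition simplicial_closure :: "'a set set \<Rightarrow> 'a set set \<Rightarrow> 'a set set" where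
  "simplicial_closure G A = {z \<in> G. \<exists>y\<in>A. z \<subseteq> y}"

definition unit_ball :: "'a set set \<Rightarrow> 'a set \<Rightarrow> 'a set set" where
  "unit_ball G x = simplicial_closure G (star G x)"

definition unit_sphere :: "'a set set \<Rightarrow> 'a set \<Rightarrow> 'a set set" where
  "unit_sphere G x = unit_ball G x - star G x"

text \<open>
  An \<open>m\<close>-tuple over \<open>A\<close> is an extensional function from \<open>{1..m}\<close> to \<open>A\<close>.
  The definition is meant for \<open>m \<ge> 1\<close>; for \<open>m = 0\<close> the empty intersection would be \<open>UNIV\<close>.
\<close>

definition higher_char :: "nat \<Rightarrow> 'a set set \<Rightarrow> int" where
  "higher_char m A =
     (\<Sum>f \<in> {f \<in> {1..m} \<rightarrow>\<^sub>E A. (\<Inter>j\<in>{1..m}. f j) \<in> A}. \<Prod>j\<in>{1..m}. simplex_weight (f j))"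

end

theory Submission
  imports Defs
begin

text \<open>
  For a simplicial complex \<open>A\<close> let \<open>W\<^sub>A(v)\<close> be the sum of the weights of all simplices of \<open>A\<close>
  that contain \<open>v\<close>. Since the non-empty subsets of a non-empty finite set have total weight \<open>1\<close>,
  \<open>w\<^sub>m(A) = (\<Sum>v\<in>A. w(v) W\<^sub>A(v)\<^sup>m)\<close>; moreover \<open>w\<^sub>m(U(x)) = W\<^sub>G(x)\<^sup>m\<close>.
  The ball \<open>B\<close> consists of the simplices \<open>z\<close> with \<open>z \<union> x \<in> G\<close>, so it is stable under adding
  or removing a vertex \<open>a \<in> x\<close>, which changes the sign of the weight. For \<open>v\<close> in the sphere \<open>S\<close>
  such an \<open>a\<close> can be chosen outside \<open>v\<close>, whence \<open>W\<^sub>B(v) = 0\<close> and \<open>W\<^sub>S(v) = - W\<^sub>G(v \<union> x)\<close>.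
  The claim thus becomes \<open>(\<Sum>v\<in>B. w(v) W\<^sub>G(v \<union> x)\<^sup>m) = W\<^sub>G(x)\<^sup>m\<close>, and here the same
  cancellation leaves only the term \<open>v = {a}\<close>.
\<close>

section \<open>Adding or removing a vertex\<close>

definition toggle :: "'a \<Rightarrow> 'a set \<Rightarrow> 'a set" where
  "toggle a v = (if a \<in> v then v - {a} else insert a v)"

lemma toggle_toggle [simp]: "toggle a (toggle a v) = v"
  by (auto simp: toggle_def)

lemma toggle_eq_empty_iff: "toggle a v = {} \<longleftrightarrow> v = {a}"
  by (auto simp: toggle_def)

lemma toggle_eq_singleton_iff: "toggle a v = {a} \<longleftrightarrow> v = {}"
  by (auto simp: toggle_def)

lemma toggle_Un: "a \<in> x \<Longrightarrow> toggle a v \<union> x = v \<union> x"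
  by (auto simp: toggle_def)

lemma subset_toggle_iff: "a \<notin> v \<Longrightarrow> v \<subseteq> toggle a y \<longleftrightarrow> v \<subseteq> y"
  by (auto simp: toggle_def)

text \<open>Truncated subtraction gives \<open>{}\<close> the weight \<open>1\<close> of a
  singleton, so the sign change would fail there.\<close>

lemma simplex_weight_insert:
  assumes "finite v" "v \<noteq> {}" "a \<notin> v"
  shows "simplex_weight (insert a v) = - simplex_weight v"
proof -
  from assms obtain k where "card v = Suc k"
    by (metis card_gt_0_iff gr0_implies_Suc)
  then show ?thesis
    using assms by (simp add: simplex_weight_def simplex_dim_def)
qed

lemma simplex_weight_toggle:
  assumes "finite v" "v \<noteq> {}" "v \<noteq> {a}"
  shows "simplex_weight (toggle a v) = - simplex_weight v"
proof (cases "a \<in> v")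
  case True
  then have "insert a (v - {a}) = v" "v - {a} \<noteq> {}"
    using assms by auto
  then show ?thesis
    using simplex_weight_insert[of "v - {a}" a] assms True by (simp add: toggle_def)
next
  case False
  then show ?thesis
    using simplex_weight_insert[of v a] assms by (simp add: toggle_def)
qed

text \<open>\<open>toggle a\<close> is a sign-reversing involution on \<open>A\<close> that leaves
  \<open>h\<close> invariant, so the sum equals its own negative.\<close>

lemma sum_weight_toggle_eq_0:
  fixes h :: "'a set \<Rightarrow> int"
  assumes fin: "\<And>v. v \<in> A \<Longrightarrow> finite v"
    and ne: "{} \<notin> A"
    and closed: "\<And>v. v \<in> A \<Longrightarrow> toggle a v \<in> A"
    and inv: "\<And>v. v \<in> A \<Longrightarrow> h (toggle a v) = h v"
  shows "(\<Sum>v\<in>A. simplex_weight v * h v) = 0"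
proof -
  have w: "simplex_weight (toggle a v) = - simplex_weight v" if "v \<in> A" for v
  proof (rule simplex_weight_toggle)
    \<comment> \<open>\<open>{a}\<close> would be toggled to \<open>{}\<close>, which is not in
      \<open>A\<close>.\<close>
    show "v \<noteq> {a}"
      using closed[OF that] ne by (auto simp: toggle_def)
  qed (use that fin ne in auto)
  have "(\<Sum>v\<in>A. simplex_weight v * h v) = (\<Sum>v\<in>A. - (simplex_weight v * h v))"
    by (rule sum.reindex_bij_witness[where i = "toggle a" and j = "toggle a"])
      (auto simp: closed inv w)
  then show ?thesis
    by (simp add: sum_negf)
qed

text \<open>Here \<open>{a}\<close> is the only member without a partner in \<open>A\<close>, since
  its toggle is \<open>{}\<close>; all other terms cancel.\<close>

lemma sum_weight_cone:
  fixes h :: "'a set \<Rightarrow> int"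
  assumes "finite A"
    and fin: "\<And>v. v \<in> A \<Longrightarrow> finite v"
    and ne: "{} \<notin> A"
    and a: "{a} \<in> A"
    and closed: "\<And>v. v \<in> A \<Longrightarrow> v \<noteq> {a} \<Longrightarrow> toggle a v \<in> A"
    and inv: "\<And>v. v \<in> A \<Longrightarrow> v \<noteq> {a} \<Longrightarrow> h (toggle a v) = h v"
  shows "(\<Sum>v\<in>A. simplex_weight v * h v) = h {a}"
proof -
  have "(\<Sum>v\<in>A - {{a}}. simplex_weight v * h v) = 0"
    by (rule sum_weight_toggle_eq_0[where a = a])
      (use assms in \<open>auto simp: toggle_eq_singleton_iff\<close>)
  moreover have "simplex_weight {a} = 1"
    by (simp add: simplex_weight_def simplex_dim_def)
  ultimately show ?thesis
    using sum.remove[OF \<open>finite A\<close> a, of "\<lambda>v. simplex_weight v * h v"] by simp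
qed

text \<open>A full simplex is a cone over each of its vertices.\<close>

lemma sum_weight_nonempty_subsets:
  assumes "finite I" "I \<noteq> {}"
  shows "(\<Sum>v\<in>{v. v \<subseteq> I \<and> v \<noteq> {}}. simplex_weight v) = 1"
proof -
  from assms obtain a where a: "a \<in> I" by auto
  have "(\<Sum>v\<in>{v. v \<subseteq> I \<and> v \<noteq> {}}. simplex_weight v * 1) = 1"
  proof (rule sum_weight_cone[where a = a and h = "\<lambda>_. 1"])
    show "toggle a v \<in> {v. v \<subseteq> I \<and> v \<noteq> {}}"
      if "v \<in> {v. v \<subseteq> I \<and> v \<noteq> {}}" "v \<noteq> {a}" for v
      using that a by (auto simp: toggle_def)
  qed (use assms a in \<open>auto intro: finite_subset\<close>)
  then show ?thesis by simp
qed

section \<open>Star weights \<open>W\<^sub>A(v)\<close> and the characteristics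
  \<open>w\<^sub>m\<close>\<close>

definition star_weight :: "'a set set \<Rightarrow> 'a set \<Rightarrow> int" where
  "star_weight A v = (\<Sum>y\<in>star A v. simplex_weight y)"

lemma finite_star: "finite A \<Longrightarrow> finite (star A v)"
  by (simp add: star_def)

lemma star_weight_power:
  assumes "finite A"
  shows "star_weight A v ^ m =
    (\<Sum>f\<in>{1..m} \<rightarrow>\<^sub>E star A v. \<Prod>j\<in>{1..m}. simplex_weight (f j))"
proof -
  have "star_weight A v ^ m = (\<Prod>j\<in>{1..m}. \<Sum>y\<in>star A v. simplex_weight y)"
    by (simp add: star_weight_def)
  also have "\<dots> = (\<Sum>f\<in>{1..m} \<rightarrow>\<^sub>E star A v. \<Prod>j\<in>{1..m}. simplex_weight (f j))"
    by (rule prod_sum_PiE) (auto intro: finite_star assms)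
  finally show ?thesis .
qed

text \<open>The condition that the intersection lies in \<open>A\<close> is replaced by the total
  weight of the members of \<open>A\<close> inside it; exchanging the sums then produces powers of
  star weights.\<close>

lemma higher_char_complex:
  fixes A :: "'a set set"
  assumes A: "finite_abstract_simplicial_complex A" and m: "m \<ge> 1"
  shows "higher_char m A = (\<Sum>v\<in>A. simplex_weight v * star_weight A v ^ m)"
proof -
  let ?F = "{1..m} \<rightarrow>\<^sub>E A"
  let ?I = "\<lambda>f. \<Inter>j\<in>{1..m}. (f j :: 'a set)"
  let ?P = "\<lambda>f. \<Prod>j\<in>{1..m}. simplex_weight (f j :: 'a set)"
  have finA: "finite A"
    using A by (simp add: finite_abstract_simplicial_complex_def)
  then have finF: "finite ?F"
    by (simp add: finite_PiE)
  have inner: "(\<Sum>v\<in>{v\<in>A. v \<subseteq> ?I f}. simplex_weight v) = (if ?I f \<in> A then 1 else 0)"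
    if f: "f \<in> ?F" for f
  proof -
    \<comment> \<open>As \<open>m \<ge> 1\<close>, the intersection is contained in the simplex
      \<open>f 1\<close>, so it lies in \<open>A\<close> as soon as it is non-empty.\<close>
    have f1: "f 1 \<in> A" "?I f \<subseteq> f 1"
      using f m by auto
    show ?thesis
    proof (cases "?I f = {}")
      case True
      moreover have "{} \<notin> A"
        using A by (auto simp: finite_abstract_simplicial_complex_def)
      ultimately show ?thesis
        by (auto intro!: sum.neutral)
    next
      case False
      then have I: "?I f \<in> A"
        using A f1 unfolding finite_abstract_simplicial_complex_def by blast
      have "{v\<in>A. v \<subseteq> ?I f} = {v. v \<subseteq> ?I f \<and> v \<noteq> {}}"
        using A I unfolding finite_abstract_simplicial_complex_def by blast
      moreover have "finite (?I f)"
        using A I by (simp add: finite_abstract_simplicial_complex_def)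
      ultimately show ?thesis
        using sum_weight_nonempty_subsets[OF _ False] I by simp
    qed
  qed
  \<comment> \<open>All entries contain \<open>v\<close> exactly when their intersection
    does.\<close>
  have star: "{1..m} \<rightarrow>\<^sub>E star A v = {f\<in>?F. v \<subseteq> ?I f}" for v
    by (simp only: set_eq_iff PiE_iff star_def mem_Collect_eq le_INF_iff) blast
  have "(\<Sum>v\<in>A. simplex_weight v * star_weight A v ^ m)
      = (\<Sum>v\<in>A. \<Sum>f\<in>{f\<in>?F. v \<subseteq> ?I f}. simplex_weight v * ?P f)"
    by (simp only: star_weight_power[OF finA] star sum_distrib_left)
  also have "\<dots> = (\<Sum>f\<in>?F. \<Sum>v\<in>{v\<in>A. v \<subseteq> ?I f}. simplex_weight v * ?P f)"
    by (rule sum.swap_restrict[OF finA finF])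
  also have "\<dots> = (\<Sum>f\<in>?F. (if ?I f \<in> A then 1 else 0) * ?P f)"
    by (rule sum.cong) (simp_all only: inner flip: sum_distrib_right)
  also have "\<dots> = (\<Sum>f\<in>?F. if ?I f \<in> A then ?P f else 0)"
    by (rule sum.cong) auto
  also have "\<dots> = higher_char m A"
    unfolding higher_char_def by (rule sum.inter_filter[OF finF, symmetric])
  finally show ?thesis ..
qed

text \<open>An intersection of members of the star contains \<open>x\<close>, so it is a non-empty
  face and lies in the star again: every tuple counts.\<close>

lemma higher_char_star:
  fixes G :: "'a set set"
  assumes G: "finite_abstract_simplicial_complex G" and x: "x \<in> G" and m: "m \<ge> 1"
  shows "higher_char m (star G x) = star_weight G x ^ m"
proof -
  have "(\<Inter>j\<in>{1..m}. f j) \<in> star G x" if "f \<in> {1..m} \<rightarrow>\<^sub>E star G x" for f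
  proof -
    let ?I = "\<Inter>j\<in>{1..m}. f j"
    have "x \<subseteq> ?I" "?I \<subseteq> f 1" "f 1 \<in> G"
      using that m by (auto simp: star_def PiE_iff)
    moreover have "x \<noteq> {}"
      using G x by (simp add: finite_abstract_simplicial_complex_def)
    ultimately show ?thesis
      using G unfolding finite_abstract_simplicial_complex_def star_def by blast
  qed
  then have "{f \<in> {1..m} \<rightarrow>\<^sub>E star G x. (\<Inter>j\<in>{1..m}. f j) \<in> star G x} = {1..m} \<rightarrow>\<^sub>E star G x"
    by blast
  moreover have "finite G"
    using G by (simp add: finite_abstract_simplicial_complex_def)
  ultimately show ?thesis
    by (simp only: higher_char_def star_weight_power)
qed

section \<open>Unit balls and unit spheres as complexes\<close>

lemma mem_unit_ball_iff:
  assumes G: "finite_abstract_simplicial_complex G" and x: "x \<in> G"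
  shows "z \<in> unit_ball G x \<longleftrightarrow> z \<noteq> {} \<and> z \<union> x \<in> G"
proof
  assume "z \<in> unit_ball G x"
  then obtain y where "z \<in> G" "z \<subseteq> y" "x \<subseteq> y" "y \<in> G"
    by (auto simp: unit_ball_def simplicial_closure_def star_def)
  then show "z \<noteq> {} \<and> z \<union> x \<in> G"
    using G unfolding finite_abstract_simplicial_complex_def
    by (metis Un_empty Un_least)
next
  assume z: "z \<noteq> {} \<and> z \<union> x \<in> G"
  then have "z \<in> G"
    using G unfolding finite_abstract_simplicial_complex_def by (metis Un_upper1)
  with z show "z \<in> unit_ball G x"
    by (auto simp: unit_ball_def simplicial_closure_def star_def)
qed

lemma subcomplex:
  assumes "finite_abstract_simplicial_complex G" "A \<subseteq> G"
    and "\<And>y z. y \<in> A \<Longrightarrow> z \<in> G \<Longrightarrow> z \<subseteq> y \<Longrightarrow> z \<in> A"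
  shows "finite_abstract_simplicial_complex A"
  unfolding finite_abstract_simplicial_complex_def
proof (intro conjI ballI allI impI)
  note G = assms(1)[unfolded finite_abstract_simplicial_complex_def]
  show "finite A"
    using G assms(2) by (blast intro: finite_subset)
  fix y assume "y \<in> A"
  then show "finite y" "y \<noteq> {}"
    using G assms(2) by blast+
  fix z assume "z \<subseteq> y \<and> z \<noteq> {}"
  with \<open>y \<in> A\<close> show "z \<in> A"
    using G assms(2,3) by (meson subsetD)
qed

lemma complex_unit_ball:
  assumes "finite_abstract_simplicial_complex G"
  shows "finite_abstract_simplicial_complex (unit_ball G x)"
  using assms by (rule subcomplex) (auto simp: unit_ball_def simplicial_closure_def)

text \<open>A face of a simplex not containing \<open>x\<close> does not contain \<open>x\<close>
  either.\<close>

lemma complex_unit_sphere: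
  assumes "finite_abstract_simplicial_complex G"
  shows "finite_abstract_simplicial_complex (unit_sphere G x)"
  using assms
  by (rule subcomplex) (auto simp: unit_sphere_def unit_ball_def simplicial_closure_def star_def)

section \<open>Cancellation in the ball and the sphere\<close>

theorem lemma3:
  fixes G :: "'a set set" and x :: "'a set" and m :: nat
  assumes "finite_abstract_simplicial_complex G"
    and "x \<in> G"
    and "m \<ge> 1"
  shows "higher_char m (unit_ball G x) =
    higher_char m (star G x) - (-1) ^ m * higher_char m (unit_sphere G x)"
proof -
  note ball_iff = mem_unit_ball_iff[OF assms(1,2)]
  let ?U = "star G x" and ?B = "unit_ball G x" and ?S = "unit_sphere G x"
  have B: "finite ?B" "\<And>v. v \<in> ?B \<Longrightarrow> finite v" "{} \<notin> ?B"
    using complex_unit_ball[OF assms(1), of x]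
    by (auto simp: finite_abstract_simplicial_complex_def)
  have x: "x \<noteq> {}"
    using assms(1,2) by (simp add: finite_abstract_simplicial_complex_def)
  then have UB: "?U \<subseteq> ?B"
    by (auto simp: ball_iff star_def Un_absorb2)
  have "?S \<subseteq> ?B"
    by (auto simp: unit_sphere_def)
  have split: "(\<Sum>v\<in>?B. h v) = (\<Sum>v\<in>?U. h v) + (\<Sum>v\<in>?S. h v)" for h :: "'a set \<Rightarrow> int"
    using sum.subset_diff[OF UB B(1), of h] by (simp add: unit_sphere_def)
  \<comment> \<open>Membership depends only on \<open>v \<union> x\<close>, which toggling a vertex
    of \<open>x\<close> preserves, and on non-emptiness, which excluding \<open>{a}\<close>
    secures.\<close>
  have toggle_ball: "toggle a v \<in> ?B" if "v \<in> ?B" "v \<noteq> {a}" "a \<in> x" for a v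
    using that by (simp add: ball_iff toggle_Un toggle_eq_empty_iff)

  have ball_star_U: "star_weight ?B v = star_weight G v" if "v \<in> ?U" for v
  proof -
    \<comment> \<open>Every simplex containing \<open>v\<close> contains \<open>x\<close> and hence
      lies in the ball.\<close>
    have "star ?B v = star G v"
      using that UB by (auto simp: star_def unit_ball_def simplicial_closure_def)
    then show ?thesis by (simp add: star_weight_def)
  qed
  have ball_star_S: "star_weight ?B v = 0" if v: "v \<in> ?S" for v
  proof -
    \<comment> \<open>\<open>v\<close> does not contain \<open>x\<close>; a vertex of
      \<open>x\<close> outside \<open>v\<close> can be toggled without leaving the star of
      \<open>v\<close> in the ball.\<close>
    obtain a where a: "a \<in> x" "a \<notin> v"
      using v by (auto simp: unit_sphere_def star_def unit_ball_def simplicial_closure_def)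
    have "v \<noteq> {}"
      using v \<open>?S \<subseteq> ?B\<close> B(3) by auto
    have "(\<Sum>y\<in>star ?B v. simplex_weight y * 1) = 0"
    proof (rule sum_weight_toggle_eq_0[where a = a])
      show "toggle a y \<in> star ?B v" if "y \<in> star ?B v" for y
        using that a \<open>v \<noteq> {}\<close> by (auto simp: star_def subset_toggle_iff intro!: toggle_ball)
    qed (use B in \<open>auto simp: star_def\<close>)
    then show ?thesis by (simp add: star_weight_def)
  qed
  have sphere_star: "star_weight ?S v = - star_weight G (v \<union> x)" if v: "v \<in> ?S" for v
  proof -
    \<comment> \<open>The members of the ball containing \<open>v\<close> are split by whether they
      contain \<open>x\<close>.\<close>
    have "star ?B v = star G (v \<union> x) \<union> star ?S v" "star G (v \<union> x) \<inter> star ?S v = {}"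
      using UB by (auto simp: star_def unit_sphere_def unit_ball_def simplicial_closure_def)
    moreover have "finite (star ?B v)"
      using B(1) by (rule finite_star)
    ultimately have "star_weight ?B v = star_weight G (v \<union> x) + star_weight ?S v"
      unfolding star_weight_def by (metis finite_Un sum.union_disjoint)
    then show ?thesis
      using ball_star_S[OF v] by simp
  qed

  obtain a where a: "a \<in> x"
    using x by auto
  then have "{a} \<in> ?B"
    using assms(2) by (simp add: ball_iff insert_absorb)
  \<comment> \<open>Toggling \<open>a\<close> leaves the power unchanged, so only
    \<open>v = {a}\<close> survives, where \<open>v \<union> x = x\<close>.\<close>
  then have "(\<Sum>v\<in>?B. simplex_weight v * star_weight G (v \<union> x) ^ m)
      = star_weight G ({a} \<union> x) ^ m"
    by (intro sum_weight_cone B) (simp_all add: toggle_ball toggle_Un a)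
  also have "\<dots> = higher_char m ?U"
    using a higher_char_star[OF assms] by (simp add: insert_absorb)
  finally have total: "(\<Sum>v\<in>?U. simplex_weight v * star_weight G (v \<union> x) ^ m)
      + (\<Sum>v\<in>?S. simplex_weight v * star_weight G (v \<union> x) ^ m) = higher_char m ?U"
    by (simp only: split)

  have "higher_char m ?B = (\<Sum>v\<in>?U. simplex_weight v * star_weight ?B v ^ m)
      + (\<Sum>v\<in>?S. simplex_weight v * star_weight ?B v ^ m)"
    by (simp only: higher_char_complex[OF complex_unit_ball[OF assms(1)] assms(3)] split)
  \<comment> \<open>\<open>m \<ge> 1\<close> matters because \<open>0 ^ 0 = 1\<close>.\<close>
  also have "(\<Sum>v\<in>?S. simplex_weight v * star_weight ?B v ^ m) = 0"
    using assms(3) by (intro sum.neutral) (simp add: ball_star_S)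
  also have "(\<Sum>v\<in>?U. simplex_weight v * star_weight ?B v ^ m)
      = (\<Sum>v\<in>?U. simplex_weight v * star_weight G (v \<union> x) ^ m)"
    by (rule sum.cong) (auto simp: ball_star_U star_def Un_absorb2)
  finally have ball: "higher_char m ?B
      = (\<Sum>v\<in>?U. simplex_weight v * star_weight G (v \<union> x) ^ m)"
    by simp

  have "(-1) ^ m * higher_char m ?S
      = (\<Sum>v\<in>?S. (-1) ^ m * (simplex_weight v * star_weight ?S v ^ m))"
    by (simp only: higher_char_complex[OF complex_unit_sphere[OF assms(1)] assms(3)]
        sum_distrib_left)
  also have "\<dots> = (\<Sum>v\<in>?S. simplex_weight v * star_weight G (v \<union> x) ^ m)"
  proof (rule sum.cong)
    fix v assume "v \<in> ?S"
    then show "(-1) ^ m * (simplex_weight v * star_weight ?S v ^ m)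
        = simplex_weight v * star_weight G (v \<union> x) ^ m"
      \<comment> \<open>The factor \<open>(-1) ^ m\<close> merges into the power and cancels the
        minus sign of \<open>sphere_star\<close>.\<close>
      by (simp add: sphere_star mult.left_commute flip: power_mult_distrib)
  qed simp
  finally show ?thesis
    using ball total by simp
qed

end
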